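(* $\widehat{K}_{2,2,2}\notin\mathfrak{N}$.
   Context: All graphs are finite, without loops or multiple edges. An interval $t$-coloring of a graph $H$ is a proper edge-coloring of $H$ with colors $1,\ldots,t$ such that every color is used and for every vertex $v$ the set of colors of edges incident to $v$ is an interval of integers. $\mathfrak{N}$ denotes the set of graphs having an interval $t$-coloring for some positive integer $t$. $K_{2,2,2}$ is the complete $3$-partite graph with two vertices in each part (vertices $v_1,\ldots,v_6$, with parts $\{v_1,v_2\},\{v_3,v_4\},\{v_5,v_6\}$). For a graph $G$, $\widehat{G}$ is the graph obtained by subdividing every edge $v_iv_j$ of $G$ with a new vertex $w_{ij}$ (replacing $v_iv_j$ by $v_iw_{ij},v_jw_{ij}$) and then adding a new vertex $u$ adjacent to all the subdivision vertices $w_{ij}$. Thus $\widehat{K}_{2,2,2}$ is a bipartite graph with $19$ vertices and maximum degree $12$. *)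

theory Defs
  imports Main
begin

text \<open>A graph is a vertex set together with a set of two-element sets of vertices.\<close>

type_synonym 'a graph = "'a set \<times> 'a set set"

abbreviation verts :: "'a graph \<Rightarrow> 'a set" where
  "verts G \<equiv> fst G"

abbreviation edges :: "'a graph \<Rightarrow> 'a set set" where
  "edges G \<equiv> snd G"

definition simple_graph :: "'a graph \<Rightarrow> bool" where
  "simple_graph G \<longleftrightarrow> finite (verts G) \<and> (\<forall>e\<in>edges G. e \<subseteq> verts G \<and> card e = 2)"

definition incident_edges :: "'a graph \<Rightarrow> 'a \<Rightarrow> 'a set set" where
  "incident_edges G v = {e \<in> edges G. v \<in> e}"

definition proper_edge_coloring :: "'a graph \<Rightarrow> ('a set \<Rightarrow> nat) \<Rightarrow> bool" where
  "proper_edge_coloring G c \<longleftrightarrow>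
     (\<forall>e\<in>edges G. \<forall>f\<in>edges G. e \<noteq> f \<and> e \<inter> f \<noteq> {} \<longrightarrow> c e \<noteq> c f)"

text \<open>For an isolated vertex the set of incident colors is empty, which counts as an interval.\<close>

definition interval_coloring :: "'a graph \<Rightarrow> nat \<Rightarrow> ('a set \<Rightarrow> nat) \<Rightarrow> bool" where
  "interval_coloring G t c \<longleftrightarrow>
     proper_edge_coloring G c \<and> c ` edges G = {1..t} \<and>
     (\<forall>v\<in>verts G. \<exists>a b. c ` incident_edges G v = {a..b})"

definition interval_colorable_graphs :: "'a graph set" ("\<NN>") where
  "\<NN> = {G. simple_graph G \<and> (\<exists>t>0. \<exists>c. interval_coloring G t c)}"

definition complete_multipartite :: "'a set set \<Rightarrow> 'a graph" where
  "complete_multipartite P =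
     (\<Union>P, {{x, y} |x y. \<exists>A\<in>P. \<exists>B\<in>P. A \<noteq> B \<and> x \<in> A \<and> y \<in> B})"

definition K222 :: "nat graph" where
  "K222 = complete_multipartite {{1, 2}, {3, 4}, {5, 6}}"

text \<open>\<open>Orig v\<close> is the original vertex \<open>v\<close>, \<open>Subdiv {v\<^sub>i, v\<^sub>j}\<close> is the subdivision vertex
  \<open>w\<^sub>i\<^sub>j\<close>, and \<open>Apex\<close> is \<open>u\<close>.\<close>

datatype 'a hat_vertex = Orig 'a | Subdiv "'a set" | Apex

definition hat :: "'a graph \<Rightarrow> 'a hat_vertex graph" where
  "hat G =
     (Orig ` verts G \<union> Subdiv ` edges G \<union> {Apex},
      {{Orig v, Subdiv e} |v e. e \<in> edges G \<and> v \<in> e} \<union> {{Apex, Subdiv e} |e. e \<in> edges G})"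

lemma verts_K222: "verts K222 = {1, 2, 3, 4, 5, 6}"
  by (auto simp: K222_def complete_multipartite_def)

lemma edges_complete_tripartite:
  assumes "A \<noteq> B" "A \<noteq> C" "B \<noteq> C"
  shows "edges (complete_multipartite {A, B, C}) =
    (\<Union>x\<in>A. (\<lambda>y. {x, y}) ` (B \<union> C)) \<union> (\<Union>x\<in>B. (\<lambda>y. {x, y}) ` C)" (is "?L = ?R")
proof
  show "?L \<subseteq> ?R"
  proof
    fix e assume "e \<in> ?L"
    then obtain x y where e: "e = {x, y}"
      and "\<exists>S\<in>{A, B, C}. \<exists>T\<in>{A, B, C}. S \<noteq> T \<and> x \<in> S \<and> y \<in> T"
      unfolding complete_multipartite_def snd_conv by blast
    then consider "x \<in> A" "y \<in> B \<union> C" | "y \<in> A" "x \<in> B \<union> C" | "x \<in> B" "y \<in> C" | "y \<in> B" "x \<in> C"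
      by auto
    then show "e \<in> ?R"
    proof cases
      case 1 then show ?thesis unfolding e by blast
    next
      case 2 then show ?thesis unfolding e insert_commute[of x] by blast
    next
      case 3 then show ?thesis unfolding e by blast
    next
      case 4 then show ?thesis unfolding e insert_commute[of x] by blast
    qed
  qed
  have "{x, y} \<in> ?L" if "S \<in> {A, B, C}" "T \<in> {A, B, C}" "S \<noteq> T" "x \<in> S" "y \<in> T" for x y S T
    using that unfolding complete_multipartite_def snd_conv by blast
  then show "?R \<subseteq> ?L"
    using assms by (auto simp del: snd_conv)
qed

lemma edges_K222:
  "edges K222 = {{1,3}, {1,4}, {1,5}, {1,6}, {2,3}, {2,4}, {2,5}, {2,6},
                 {3,5}, {3,6}, {4,5}, {4,6}}"
proof -
  have "{1, 2} \<noteq> {3, 4::nat}" "{1, 2} \<noteq> {5, 6::nat}" "{3, 4} \<noteq> {5, 6::nat}"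
    by (simp_all add: doubleton_eq_iff)
  from edges_complete_tripartite[OF this] show ?thesis
    unfolding K222_def by (simp only:) auto
qed

lemma simple_graph_K222: "simple_graph K222"
  unfolding simple_graph_def edges_K222 verts_K222 by simp

lemma simple_graph_hat:
  assumes "simple_graph G"
  shows "simple_graph (hat G)"
proof -
  have "finite (edges G)"
    using assms finite_subset[of "edges G" "Pow (verts G)"] unfolding simple_graph_def by auto
  then show ?thesis
    using assms unfolding simple_graph_def hat_def by (auto 0 3)
qed

lemma simple_graph_hat_K222: "simple_graph (hat K222)"
  by (rule simple_graph_hat[OF simple_graph_K222])

lemma card_edges_K222: "card (edges K222) = 12"
  unfolding edges_K222 by (simp add: doubleton_eq_iff)

lemma card_verts_hat_K222: "card (verts (hat K222)) = 19"
proof -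
  have fin: "finite (edges K222)" "finite (verts K222)"
    by (simp_all add: edges_K222 verts_K222)
  have "card (Orig ` verts K222 \<union> Subdiv ` edges K222) = 6 + 12"
    using fin card_edges_K222
    by (subst card_Un_disjoint) (auto simp: card_image inj_on_def verts_K222)
  moreover have "verts (hat K222) = insert Apex (Orig ` verts K222 \<union> Subdiv ` edges K222)"
    by (auto simp: hat_def)
  moreover have "Apex \<notin> Orig ` verts K222 \<union> Subdiv ` edges K222" by auto
  ultimately show ?thesis using fin by simp
qed

end

theory Submission
  imports Defs
begin

text \<open>Shift the colors so that the edges at the apex get the colors \<open>1, \<dots>, 12\<close>. A subdivision vertex
  sees three consecutive colors and an original vertex four, so the edges of \<open>K\<^sub>2\<^sub>,\<^sub>2\<^sub>,\<^sub>2\<close> whose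
  apex colors are \<open>1\<close> and \<open>12\<close> must lie as far apart as possible: they are \<open>ij\<close> and \<open>kl\<close> with \<open>i, k\<close>
  and \<open>j, l\<close> non-adjacent, and all the color intervals at \<open>i, j, k, l\<close> are forced, as are the apex
  colors \<open>7\<close> of \<open>il\<close> and \<open>6\<close> of \<open>jk\<close>. The apex color \<open>11\<close> can then only belong to an edge from \<open>l\<close> to
  one of the remaining two vertices, which forces a second edge of apex color \<open>6\<close>.\<close>

text \<open>Here \<open>p u v\<close> is the color of the edge from the apex to the subdivision vertex of \<open>uv\<close>, and
  \<open>f u v\<close> is the color of the edge from \<open>u\<close> to that vertex.\<close>

lemma no_hat_coloring_if_one_non_neighbour:
  fixes adj :: "'a \<Rightarrow> 'a \<Rightarrow> bool" and f p :: "'a \<Rightarrow> 'a \<Rightarrow> int"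
  assumes sym: "\<And>u v. adj u v \<Longrightarrow> adj v u \<and> u \<noteq> v \<and> u \<in> V \<and> v \<in> V"
    and one: "\<And>u v w. u \<in> V \<Longrightarrow> v \<in> V \<Longrightarrow> w \<in> V \<Longrightarrow> u \<noteq> v \<Longrightarrow> u \<noteq> w \<Longrightarrow> v \<noteq> w \<Longrightarrow> adj u v \<or> adj u w"
    and p_sym: "\<And>u v. p u v = p v u"
    and f_p: "\<And>u v. adj u v \<Longrightarrow> f u v \<noteq> p u v \<and> \<bar>f u v - p u v\<bar> \<le> 2"
    and f_f: "\<And>u v. adj u v \<Longrightarrow> f u v \<noteq> f v u \<and> \<bar>f u v - f v u\<bar> \<le> 2"
    and f_vertex: "\<And>u v w. adj u v \<Longrightarrow> adj u w \<Longrightarrow> v \<noteq> w \<Longrightarrow> f u v \<noteq> f u w \<and> \<bar>f u v - f u w\<bar> \<le> 3"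
    and p_inj: "\<And>u v u' v'. adj u v \<Longrightarrow> adj u' v' \<Longrightarrow> p u v = p u' v' \<Longrightarrow> {u, v} = {u', v'}"
    and p1: "adj a1 b1" "p a1 b1 = 1"
    and p12: "adj a12 b12" "p a12 b12 = 12"
    and p11: "adj a11 b11" "p a11 b11 = 11"
  shows False
proof -
  \<comment> \<open>The smaller of the two other colors is placed at \<open>j\<close>. Both lie
    within 2 of 1, whence the unequal bounds 3 and 2 below; the edge of apex color 12 is treated as
    a mirror image.\<close>
  obtain i j where ij: "adj i j" "adj j i" "p i j = 1" "f j i < f i j"
    using p1 sym p_sym f_f by (metis linorder_neq_iff)
  obtain k l where kl: "adj k l" "adj l k" "p k l = 12" "f k l < f l k"
    using p12 sym p_sym f_f by (metis linorder_neq_iff)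
  have V: "i \<in> V" "j \<in> V" "k \<in> V" "l \<in> V" and "i \<noteq> j" "k \<noteq> l"
    using sym ij kl by auto
  have fij: "f i j \<le> 3" "f j i \<le> 2"
    using f_p[OF ij(1)] f_p[OF ij(2)] f_f[OF ij(1)] ij p_sym[of i j] by auto
  have fkl: "f k l \<ge> 10" "f l k \<ge> 11"
    using f_p[OF kl(1)] f_p[OF kl(2)] f_f[OF kl(1)] kl p_sym[of k l] by auto
  \<comment> \<open>Colors at one vertex differ by at most 3, so the four bounds are 3 + 3, 2 + 3,
    10 - 3 and 11 - 3.\<close>
  have at_i: "f i v \<le> 6" if "adj i v" for v
    using f_vertex[OF ij(1) that] fij by force
  have at_j: "f j v \<le> 5" if "adj j v" for v
    using f_vertex[OF ij(2) that] fij by force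
  have at_k: "f k v \<ge> 7" if "adj k v" for v
    using f_vertex[OF kl(1) that] fkl by force
  have at_l: "f l v \<ge> 8" if "adj l v" for v
    using f_vertex[OF kl(2) that] fkl by force
  have disj: "i \<noteq> k" "i \<noteq> l" "j \<noteq> k" "j \<noteq> l"
    using at_i[of j] at_i[of k] at_i[of l] at_j[of k] at_j[of l] ij kl fkl by auto
  \<comment> \<open>The colors \<open>f j l\<close>, at most 5, and \<open>f l j\<close>, at least
    8, would differ by more than 2.\<close>
  have "\<not> adj j l"
    using f_f[of j l] at_j[of l] at_l[of j] sym[of j l] by auto
  then have jk: "adj j k" and li: "adj l i"
    using one[of j k l] one[of l i j] sym[of l j] V disj \<open>i \<noteq> j\<close> \<open>k \<noteq> l\<close> by auto
  then have kj: "adj k j" and il: "adj i l"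
    using sym by auto
  \<comment> \<open>The bounds 6 and 8 are exactly 2 apart, so both are attained, and the apex color
    must lie strictly between them.\<close>
  have fil: "f i l = 6" "f l i = 8" "p i l = 7"
    using f_f[OF il] f_p[OF il] f_p[OF li] at_i[OF il] at_l[OF li] p_sym[of i l] by auto
  have fjk: "f j k = 5" "f k j = 7" "p j k = 6"
    using f_f[OF jk] f_p[OF jk] f_p[OF kj] at_j[OF jk] at_k[OF kj] p_sym[of j k] by auto
  \<comment> \<open>The span 3 at a vertex now works in the other direction:
    \<open>f i l = 6\<close> forces \<open>f i j\<close> up to 3, and similarly at \<open>j\<close>,
    \<open>k\<close>, \<open>l\<close>.\<close>
  have corner: "f i j = 3" "f j i = 2" "f k l = 10" "f l k = 11"
    using fij fkl fil fjk f_vertex[OF ij(1) il] f_vertex[OF ij(2) jk] f_vertex[OF kl(1) kj]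
      f_vertex[OF kl(2) li] disj by auto
  \<comment> \<open>Color 6 at \<open>i\<close> and color 7 at \<open>k\<close> are taken by the
    edges to \<open>l\<close> and \<open>j\<close>, so \<open>f i k\<close> would be at most 5 and
    \<open>f k i\<close> at least 8.\<close>
  have "\<not> adj i k"
  proof
    assume "adj i k"
    then show False
      using f_vertex[of i k l] f_vertex[of k i j] at_i[of k] at_k[of i] f_f[of i k] sym[of i k]
        il kj fil fjk \<open>k \<noteq> l\<close> \<open>i \<noteq> j\<close> by auto
  qed
  have nbr: "adj i y" "adj j y" "adj k y" "adj l y" "adj y i" "adj y j" "adj y k" "adj y l"
    if "y \<in> V" "y \<notin> {i, j, k, l}" for y
  proof -
    show "adj i y" "adj j y" "adj k y" "adj l y"
      using one[of i y k] one[of j y l] one[of k y i] one[of l y j] sym[of k i] sym[of l j]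
        \<open>\<not> adj i k\<close> \<open>\<not> adj j l\<close> that V disj by auto
    then show "adj y i" "adj y j" "adj y k" "adj y l"
      using sym by auto
  qed
  \<comment> \<open>The color ranges are now 3 to 6 at \<open>i\<close>, 2 to 5 at \<open>j\<close>,
    7 to 10 at \<open>k\<close> and 8 to 11 at \<open>l\<close>, with both ends taken; an edge to
    \<open>y\<close> gets one of the two inner colors.\<close>
  have fi: "f i y = 4 \<or> f i y = 5" and fj: "f j y = 3 \<or> f j y = 4"
    and fk: "f k y = 8 \<or> f k y = 9" and fl: "f l y = 9 \<or> f l y = 10"
    and fyj: "f y j \<le> 6"
    if "y \<in> V" "y \<notin> {i, j, k, l}" for y
  proof -
    show "f i y = 4 \<or> f i y = 5"
      using f_vertex[OF ij(1) nbr(1)[OF that]] f_vertex[OF il nbr(1)[OF that]] corner fil that by auto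
    show *: "f j y = 3 \<or> f j y = 4"
      using f_vertex[OF ij(2) nbr(2)[OF that]] f_vertex[OF jk nbr(2)[OF that]] corner fjk that by auto
    show "f k y = 8 \<or> f k y = 9"
      using f_vertex[OF kl(1) nbr(3)[OF that]] f_vertex[OF kj nbr(3)[OF that]] corner fjk that by auto
    show "f l y = 9 \<or> f l y = 10"
      using f_vertex[OF kl(2) nbr(4)[OF that]] f_vertex[OF li nbr(4)[OF that]] corner fil that by auto
    show "f y j \<le> 6"
      using * f_f[OF nbr(2)[OF that]] by auto
  qed
  have outside: "p z y \<noteq> 11" if y: "y \<in> V" "y \<notin> {i, j, k, l}" and z: "z \<in> {i, j, k, l}" for y z
  proof
    assume p: "p z y = 11"
    have "z \<noteq> i" "z \<noteq> j"
      using p fi[OF y] fj[OF y] f_p[OF nbr(1)[OF y]] f_p[OF nbr(2)[OF y]] by auto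
    \<comment> \<open>Here apex color 11 would force \<open>f k y = 9\<close> and
      \<open>f y k = 10\<close>, more than 3 above \<open>f y j\<close>.\<close>
    moreover have "z \<noteq> k"
      using p fk[OF y] fyj[OF y] f_p[OF nbr(3)[OF y]] f_p[OF nbr(7)[OF y]] p_sym[of k y]
        f_f[OF nbr(3)[OF y]] f_vertex[OF nbr(6)[OF y] nbr(7)[OF y]] disj by auto
    ultimately have "p l y = 11"
      using p z by auto
    \<comment> \<open>At \<open>y\<close>, 11 - 2 is a lower bound for \<open>f y l\<close> and 6 +
      3 an upper bound.\<close>
    then have "f y l = 9" "f y j = 6"
      using fyj[OF y] f_p[OF nbr(8)[OF y]] p_sym[of l y] f_vertex[OF nbr(6)[OF y] nbr(8)[OF y]] disj
      by auto
    then have "f y i = 7 \<or> f y i = 8"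
      using f_vertex[OF nbr(5)[OF y] nbr(6)[OF y]] f_vertex[OF nbr(5)[OF y] nbr(8)[OF y]]
        disj \<open>i \<noteq> j\<close> by auto
    \<comment> \<open>Since \<open>f i y\<close> is at most 5, only \<open>f y i = 7\<close> with
      \<open>f i y = 5\<close> remains, and the apex color lies between them. But 6 is already the
      apex color of \<open>j k\<close>.\<close>
    then have "p i y = 6"
      using fi[OF y] f_f[OF nbr(1)[OF y]] f_p[OF nbr(1)[OF y]] f_p[OF nbr(5)[OF y]] p_sym[of i y]
      by auto
    then have "{i, y} = {j, k}"
      using p_inj[OF nbr(1)[OF y] jk] fjk by simp
    then show False
      using y by auto
  qed
  \<comment> \<open>Again 11 - 2 = 9 = 6 + 3. Applied in both directions this makes
    \<open>f u v\<close> and \<open>f v u\<close> equal, which \<open>f_f\<close> excludes.\<close>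
  have f_eq_9: "f u v = 9" if "adj u v" "p u v = 11" "u \<notin> {i, j, k, l}" "v \<notin> {i, j, k, l}" for u v
    using that f_p[OF that(1)] f_vertex[OF that(1) nbr(6)] fyj[of u] sym[OF that(1)] by force
  have ba: "adj b11 a11" "p b11 a11 = 11" and "a11 \<in> V" "b11 \<in> V"
    using p11 sym p_sym by auto
  consider "a11 \<in> {i, j, k, l}" "b11 \<in> {i, j, k, l}" | "a11 \<in> {i, j, k, l}" "b11 \<notin> {i, j, k, l}"
    | "a11 \<notin> {i, j, k, l}" "b11 \<in> {i, j, k, l}" | "a11 \<notin> {i, j, k, l}" "b11 \<notin> {i, j, k, l}"
    by blast
  then show False
  proof cases
    \<comment> \<open>The only adjacent pairs among \<open>i\<close>, \<open>j\<close>,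
      \<open>k\<close>, \<open>l\<close> have the apex colors 1, 12, 7 and 6.\<close>
    case 1
    then show False
      using p11 ba ij kl fil fjk \<open>\<not> adj i k\<close> \<open>\<not> adj j l\<close> sym p_sym
      by (smt (verit) insert_iff empty_iff)
  next
    case 2
    then show False using outside p11 \<open>b11 \<in> V\<close> by blast
  next
    case 3
    then show False using outside ba \<open>a11 \<in> V\<close> by blast
  next
    case 4
    then show False using f_eq_9 p11 ba f_f by metis
  qed
qed

section \<open>From interval colorings of \<open>hat G\<close> to inequalities between
  colors\<close>

lemma interval_coloring_diff_less_degree:
  assumes c: "interval_coloring G t c" and v: "v \<in> verts G" and fin: "finite (incident_edges G v)"
    and e: "e \<in> incident_edges G v" and f: "f \<in> incident_edges G v"
  shows "c e < c f + card (incident_edges G v)"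
proof -
  obtain a b where ab: "c ` incident_edges G v = {a..b}"
    using c v unfolding interval_coloring_def by blast
  have "card {a..b} \<le> card (incident_edges G v)"
    unfolding ab[symmetric] using fin by (rule card_image_le)
  moreover have "c e \<in> {a..b}" "c f \<in> {a..b}"
    unfolding ab[symmetric] using e f by auto
  ultimately show ?thesis by auto
qed

lemma inj_on_incident_edges:
  assumes "proper_edge_coloring G c"
  shows "inj_on c (incident_edges G v)"
  using assms unfolding proper_edge_coloring_def incident_edges_def inj_on_def by blast

lemma incident_edges_hat_Orig:
  "incident_edges (hat G) (Orig v) = (\<lambda>e. {Orig v, Subdiv e}) ` {e \<in> edges G. v \<in> e}"
  unfolding incident_edges_def hat_def by auto

lemma incident_edges_hat_Subdiv:
  assumes "e \<in> edges G"
  shows "incident_edges (hat G) (Subdiv e) = insert {Apex, Subdiv e} ((\<lambda>v. {Orig v, Subdiv e}) ` e)"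
  using assms unfolding incident_edges_def hat_def by auto

lemma incident_edges_hat_Apex:
  "incident_edges (hat G) Apex = (\<lambda>e. {Apex, Subdiv e}) ` edges G"
  unfolding incident_edges_def hat_def by auto

lemma hat_interval_coloring_Orig:
  assumes c: "interval_coloring (hat G) t c" and "v \<in> verts G" "finite (edges G)"
    and "card {e \<in> edges G. v \<in> e} = d"
    and e: "e \<in> edges G" "v \<in> e" and e': "e' \<in> edges G" "v \<in> e'"
  shows "c {Orig v, Subdiv e} < c {Orig v, Subdiv e'} + d"
    and "e \<noteq> e' \<Longrightarrow> c {Orig v, Subdiv e} \<noteq> c {Orig v, Subdiv e'}"
proof -
  have "card (incident_edges (hat G) (Orig v)) = d"
    unfolding incident_edges_hat_Orig using assms by (subst card_image) (auto simp: inj_on_def doubleton_eq_iff)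
  moreover have "Orig v \<in> verts (hat G)"
    using assms by (simp add: hat_def)
  moreover have mem: "{Orig v, Subdiv e} \<in> incident_edges (hat G) (Orig v)"
    "{Orig v, Subdiv e'} \<in> incident_edges (hat G) (Orig v)"
    unfolding incident_edges_hat_Orig using e e' by auto
  moreover have "finite (incident_edges (hat G) (Orig v))"
    unfolding incident_edges_hat_Orig using assms by simp
  ultimately show "c {Orig v, Subdiv e} < c {Orig v, Subdiv e'} + d"
    using interval_coloring_diff_less_degree[OF c] by metis
  show "c {Orig v, Subdiv e} \<noteq> c {Orig v, Subdiv e'}" if "e \<noteq> e'"
    using inj_on_incident_edges[of "hat G" c "Orig v"] c mem that
    unfolding interval_coloring_def inj_on_def by (metis doubleton_eq_iff hat_vertex.inject(2))
qed

lemma hat_interval_coloring_Subdiv: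
  assumes c: "interval_coloring (hat G) t c" and e: "{u, v} \<in> edges G" and "u \<noteq> v"
    and x: "x \<in> {Apex, Orig u, Orig v}" and y: "y \<in> {Apex, Orig u, Orig v}"
  shows "c {x, Subdiv {u, v}} < c {y, Subdiv {u, v}} + 3"
    and "x \<noteq> y \<Longrightarrow> c {x, Subdiv {u, v}} \<noteq> c {y, Subdiv {u, v}}"
proof -
  let ?I = "incident_edges (hat G) (Subdiv {u, v})"
  have I: "?I = {{Apex, Subdiv {u, v}}, {Orig u, Subdiv {u, v}}, {Orig v, Subdiv {u, v}}}"
    unfolding incident_edges_hat_Subdiv[OF e] by simp
  then have "card ?I = 3"
    using \<open>u \<noteq> v\<close> by (simp add: doubleton_eq_iff)
  moreover have mem: "{x, Subdiv {u, v}} \<in> ?I" "{y, Subdiv {u, v}} \<in> ?I"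
    unfolding I using x y by auto
  moreover have "Subdiv {u, v} \<in> verts (hat G)"
    using e by (simp add: hat_def)
  moreover have "finite ?I"
    unfolding I by simp
  ultimately show "c {x, Subdiv {u, v}} < c {y, Subdiv {u, v}} + 3"
    using interval_coloring_diff_less_degree[OF c] by metis
  have "{x, Subdiv {u, v}} \<noteq> {y, Subdiv {u, v}}" if "x \<noteq> y"
    using that x y by (auto simp: doubleton_eq_iff)
  then show "c {x, Subdiv {u, v}} \<noteq> c {y, Subdiv {u, v}}" if "x \<noteq> y"
    using inj_on_incident_edges[of "hat G" c "Subdiv {u, v}"] c mem that
    unfolding interval_coloring_def inj_on_def by blast
qed

lemma hat_interval_coloring_Apex:
  assumes c: "interval_coloring (hat G) t c" and "finite (edges G)"
  obtains a where "bij_betw (\<lambda>e. c {Apex, Subdiv e}) (edges G) {a..<a + card (edges G)}"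
proof -
  have "inj_on (\<lambda>e. {Apex, Subdiv e}) (edges G)"
    by (auto simp: inj_on_def doubleton_eq_iff)
  moreover have "inj_on c ((\<lambda>e. {Apex, Subdiv e}) ` edges G)"
    using inj_on_incident_edges[of "hat G" c Apex] c
    unfolding interval_coloring_def incident_edges_hat_Apex by blast
  ultimately have inj: "inj_on (\<lambda>e. c {Apex, Subdiv e}) (edges G)"
    using comp_inj_on by (fastforce simp: comp_def)
  have "Apex \<in> verts (hat G)"
    by (simp add: hat_def)
  then obtain a b where ab: "(\<lambda>e. c {Apex, Subdiv e}) ` edges G = {a..b}"
    using c unfolding interval_coloring_def by (metis incident_edges_hat_Apex image_image)
  then have "card (edges G) = Suc b - a"
    using card_image[OF inj] by simp
  then have "{a..b} = {a..<a + card (edges G)}"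
    \<comment> \<open>An empty interval is covered as well: the truncated difference is then
      0.\<close>
    by auto
  then show thesis
    using that inj ab by (simp add: bij_betw_def)
qed

section \<open>Degrees and adjacency in \<open>K222\<close>, and the conclusion\<close>

lemma degree_K222:
  assumes "v \<in> verts K222"
  shows "card {e \<in> edges K222. v \<in> e} = 4"
proof -
  \<comment> \<open>As a rewrite rule this evaluates the comprehension edge by edge on the explicit
    list of edges.\<close>
  have filter_insert: "{e \<in> insert x A. v \<in> e} = (if v \<in> x then insert x {e \<in> A. v \<in> e} else {e \<in> A. v \<in> e})"
    for x :: "nat set" and A
    by auto
  show ?thesis
    using assms unfolding verts_K222 edges_K222 filter_insert
    by (elim insertE emptyE) (simp_all add: doubleton_eq_iff)
qed

text \<open>Each part has two vertices, so \<open>u\<close> misses only its partner, which cannot be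
  both \<open>v\<close> and \<open>w\<close>.\<close>

lemma K222_adjacent_or_adjacent:
  assumes "u \<in> verts K222" "v \<in> verts K222" "w \<in> verts K222" "u \<noteq> v" "u \<noteq> w" "v \<noteq> w"
  shows "{u, v} \<in> edges K222 \<or> {u, w} \<in> edges K222"
  using assms unfolding verts_K222 edges_K222
  by (elim insertE emptyE; simp add: doubleton_eq_iff)

theorem theorem12:
  shows "hat K222 \<notin> \<NN>"
proof
  assume "hat K222 \<in> \<NN>"
  then obtain t c where c: "interval_coloring (hat K222) t c"
    unfolding interval_colorable_graphs_def by blast
  have fin: "finite (edges K222)"
    by (simp add: edges_K222)
  have pair: "u \<noteq> v \<and> u \<in> verts K222 \<and> v \<in> verts K222" if "{u, v} \<in> edges K222" for u v
    using simple_graph_K222 that unfolding simple_graph_def by fastforce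
  obtain a where bij: "bij_betw (\<lambda>e. c {Apex, Subdiv e}) (edges K222) {a..<a + 12}"
    using hat_interval_coloring_Apex[OF c fin] unfolding card_edges_K222 by blast
  \<comment> \<open>The shift sends the least apex color \<open>a\<close> to 1. Integers are used
    because colors elsewhere may drop below 1.\<close>
  define p where "p u v = int (c {Apex, Subdiv {u, v}}) - int a + 1" for u v
  define f where "f u v = int (c {Orig u, Subdiv {u, v}}) - int a + 1" for u v
  have attained: "\<exists>u v. {u, v} \<in> edges K222 \<and> p u v = int s + 1" if s: "s < 12" for s
  proof -
    have "a + s \<in> (\<lambda>e. c {Apex, Subdiv e}) ` edges K222"
      using bij s unfolding bij_betw_def by simp
    then obtain e where e: "e \<in> edges K222" "c {Apex, Subdiv e} = a + s"
      by auto
    moreover obtain u v where "e = {u, v}"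
      using e simple_graph_K222 unfolding simple_graph_def by (meson card_2_iff)
    ultimately have "{u, v} \<in> edges K222 \<and> p u v = int s + 1"
      unfolding p_def by simp
    then show ?thesis by blast
  qed
  obtain a1 b1 where p1: "{a1, b1} \<in> edges K222" "p a1 b1 = 1"
    using attained[of 0] by auto
  obtain a12 b12 where p12: "{a12, b12} \<in> edges K222" "p a12 b12 = 12"
    using attained[of 11] by auto
  obtain a11 b11 where p11: "{a11, b11} \<in> edges K222" "p a11 b11 = 11"
    using attained[of 10] by auto
  show False
  proof (rule no_hat_coloring_if_one_non_neighbour[where V = "verts K222" and p = p and f = f
        and adj = "\<lambda>u v. {u, v} \<in> edges K222", OF _ _ _ _ _ _ _ p1 p12 p11])
    show "{v, u} \<in> edges K222 \<and> u \<noteq> v \<and> u \<in> verts K222 \<and> v \<in> verts K222"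
      if "{u, v} \<in> edges K222" for u v
      using that pair[OF that] by (simp add: insert_commute)
    show "{u, v} \<in> edges K222 \<or> {u, w} \<in> edges K222"
      if "u \<in> verts K222" "v \<in> verts K222" "w \<in> verts K222" "u \<noteq> v" "u \<noteq> w" "v \<noteq> w" for u v w
      using K222_adjacent_or_adjacent that .
    show "p u v = p v u" for u v
      unfolding p_def by (simp add: insert_commute)
    show "f u v \<noteq> p u v \<and> \<bar>f u v - p u v\<bar> \<le> 2" if "{u, v} \<in> edges K222" for u v
      using hat_interval_coloring_Subdiv[OF c that, of Apex "Orig u"]
        hat_interval_coloring_Subdiv[OF c that, of "Orig u" Apex] pair[OF that]
      unfolding f_def p_def by auto
    show "f u v \<noteq> f v u \<and> \<bar>f u v - f v u\<bar> \<le> 2" if "{u, v} \<in> edges K222" for u v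
      using hat_interval_coloring_Subdiv[OF c that, of "Orig v" "Orig u"]
        hat_interval_coloring_Subdiv[OF c that, of "Orig u" "Orig v"] pair[OF that]
      unfolding f_def insert_commute[of v u] by auto
    show "f u v \<noteq> f u w \<and> \<bar>f u v - f u w\<bar> \<le> 3"
      if uv: "{u, v} \<in> edges K222" and uw: "{u, w} \<in> edges K222" and "v \<noteq> w" for u v w
    proof -
      have u: "u \<in> verts K222" and ne: "{u, v} \<noteq> {u, w}"
        using pair[OF uv] \<open>v \<noteq> w\<close> by (auto simp: doubleton_eq_iff)
      show ?thesis
        using hat_interval_coloring_Orig[OF c u fin degree_K222[OF u] uv _ uw]
          hat_interval_coloring_Orig[OF c u fin degree_K222[OF u] uw _ uv] ne
        unfolding f_def by auto
    qed
    show "{u, v} = {u', v'}"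
      if "{u, v} \<in> edges K222" "{u', v'} \<in> edges K222" "p u v = p u' v'" for u v u' v'
      using that bij unfolding p_def bij_betw_def inj_on_def by auto
  qed
qed

end
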